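(* Let $n\ge 3$ be odd. For every self-dual code $C$ in $\mathbb{F}_2^{n+1}$, $\{A^{-1}:A\in\mathcal{F}_C\}=\mathcal{F}_C$.
   Context: $\mathbb{F}_2$ is the binary field. A code $C\subseteq\mathbb{F}_2^{n+1}$ is self-dual if $C=C^\perp$ (standard dot product); then $\dim C=m:=\frac{n+1}{2}$. For $\mathbf{y}\in\mathbb{F}_2^{n+1}$, $\underline{\mathbf{y}}\in\mathbb{F}_2^n$ is $\mathbf{y}$ with its last entry deleted; $\mathbf{x}^2:=\mathbf{x}\mathbf{x}^{\top}$. Let $\mathfrak{B}_C$ be the set of bases of $C$, $\mathfrak{B}_C^2$ those bases containing an even number of vectors with last entry $1$. For $\mathcal{B}=\{\mathbf{y}_1,\ldots,\mathbf{y}_m\}\in\mathfrak{B}_C$ put $A'_{\mathcal{B}}=I_n+\sum_{i=1}^m\underline{\mathbf{y}_i}^2$ and $A''_{\mathcal{B}}=I_n+\sum_{i=1}^m\underline{\mathbf{y}_i}^2+(\underline{\mathbf{y}_1}+\cdots+\underline{\mathbf{y}_m})^2$. Define $\mathcal{F}_C=\{A'_{\mathcal{B}}:\mathcal{B}\in\mathfrak{B}_C^2\}\cup\{A''_{\mathcal{B}}:\mathcal{B}\in\mathfrak{B}_C\}$ if $m$ is even, and $\mathcal{F}_C=\{A'_{\mathcal{B}}:\mathcal{B}\in\mathfrak{B}_C^2\}$ if $m$ is odd. (All these matrices are invertible over $\mathbb{F}_2$.) *)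

theory Defs
  imports "HOL-Library.Z2" "Jordan_Normal_Form.Gauss_Jordan_Elimination" "Jordan_Normal_Form.VS_Connect"
begin

definition dual_code :: "nat \<Rightarrow> bit vec set \<Rightarrow> bit vec set" where
  "dual_code N C = {x \<in> carrier_vec N. \<forall>y\<in>C. x \<bullet> y = 0}"

definition self_dual :: "nat \<Rightarrow> bit vec set \<Rightarrow> bool" where
  "self_dual N C \<longleftrightarrow> C \<subseteq> carrier_vec N \<and> C = dual_code N C"

definition code_bases :: "nat \<Rightarrow> bit vec set \<Rightarrow> bit vec set set" where
  "code_bases N C = {B. B \<subseteq> C \<and>
      LinearCombinations.module.lin_indpt class_ring (module_vec TYPE(bit) N) B \<and>
      LinearCombinations.module.span class_ring (module_vec TYPE(bit) N) B = C}"

definition code_bases2 :: "nat \<Rightarrow> bit vec set \<Rightarrow> bit vec set set" where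
  "code_bases2 N C = {B \<in> code_bases N C. even (card {y \<in> B. y $ (N - 1) = 1})}"

definition vsq :: "bit vec \<Rightarrow> bit mat" where
  "vsq x = mat_of_cols (dim_vec x) [x] * transpose_mat (mat_of_cols (dim_vec x) [x])"

definition mat_sum :: "nat \<Rightarrow> ('b \<Rightarrow> bit mat) \<Rightarrow> 'b set \<Rightarrow> bit mat" where
  "mat_sum n f S = mat n n (\<lambda>(i,j). \<Sum>s\<in>S. f s $$ (i,j))"

definition vec_sum :: "nat \<Rightarrow> ('b \<Rightarrow> bit vec) \<Rightarrow> 'b set \<Rightarrow> bit vec" where
  "vec_sum n f S = vec n (\<lambda>i. \<Sum>s\<in>S. f s $ i)"

definition A1 :: "nat \<Rightarrow> bit vec set \<Rightarrow> bit mat" where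
  "A1 n B = 1\<^sub>m n + mat_sum n (\<lambda>y. vsq (vec_first y n)) B"

definition A2 :: "nat \<Rightarrow> bit vec set \<Rightarrow> bit mat" where
  "A2 n B = 1\<^sub>m n + mat_sum n (\<lambda>y. vsq (vec_first y n)) B
             + vsq (vec_sum n (\<lambda>y. vec_first y n) B)"

definition family_F :: "nat \<Rightarrow> bit vec set \<Rightarrow> bit mat set" where
  "family_F n C =
     (if even ((n + 1) div 2)
      then A1 n ` code_bases2 (n + 1) C \<union> A2 n ` code_bases (n + 1) C
      else A1 n ` code_bases2 (n + 1) C)"

text \<open>Matrix inverse (the matrices in question are invertible).\<close>
definition mat_inv :: "bit mat \<Rightarrow> bit mat" where
  "mat_inv A = the (mat_inverse A)"

end

theory Submission
  imports Defs
begin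

text \<open>
  Write the basis vectors as the rows of a matrix \<open>[H | v]\<close>. Self-duality gives
  \<open>H H\<^sup>T = v v\<^sup>T\<close>, so the matrices \<open>I + H\<^sup>T S H\<close> with \<open>S\<close> symmetric multiply by
  \<open>(I + H\<^sup>T S H) (I + H\<^sup>T T H) = I + H\<^sup>T (S + T + S v v\<^sup>T T) H\<close>. Here \<open>A'\<close> and \<open>A''\<close> belong to
  \<open>S = I\<close> and \<open>S = I + J\<close>, where \<open>J\<close> is the all-ones matrix.
  If \<open>v\<close> has even weight, \<open>S = I\<close> is inverted by \<open>T = I + v v\<^sup>T\<close>. When \<open>v\<close> is the all-ones vector,
  this is \<open>I + J\<close>, so \<open>A'\<close> and \<open>A''\<close> of the same basis are inverse to each other. Otherwise
  \<open>v\<^sub>k = 0\<close> for some \<open>k\<close>, and \<open>T = P\<^sup>T P\<close> for \<open>P = I + e\<^sub>k v\<^sup>T + v e\<^sub>k\<^sup>T\<close>, so the inverse is \<open>A'\<close>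
  of the basis transformed by \<open>P\<close>.
  Finally, for even \<open>m\<close> the symplectic transvections of the form \<open>I + J\<close> leave \<open>A''\<close> unchanged and
  move any nonzero \<open>v\<close> to the all-ones vector; \<open>v\<close> is nonzero because a self-dual code does not
  contain the last unit vector.
\<close>

section \<open>Bits and bit vectors\<close>

text \<open>These simp rules would rewrite sums and products of bits to Boolean operations.\<close>

declare add_bit_eq_xor [simp del] mult_bit_eq_and [simp del]

lemma bit_add_self [simp]: "a + a = (0::bit)"
  by (cases a) simp_all

lemma bit_add_self_left [simp]: "a + (a + b) = (b::bit)"
  by (simp flip: add.assoc)

lemma bit_mult_self [simp]: "a * a = (a::bit)"
  by (cases a) simp_all

lemma of_nat_bit: "(of_nat k :: bit) = of_bool (odd k)"
  by (induction k) auto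

text \<open>Converts the parity condition on last entries into a linear equation over the binary
  field.\<close>

lemma sum_bit_eq_parity:
  assumes "finite S"
  shows "(\<Sum>s\<in>S. f s :: bit) = of_bool (odd (card {s\<in>S. f s = 1}))"
proof -
  have "(\<Sum>s\<in>S. f s) = (\<Sum>s\<in>{s\<in>S. f s = 1}. 1)"
    using assms by (intro sum.mono_neutral_cong_right) auto
  then show ?thesis by (simp add: of_nat_bit)
qed

lemma bit_vec_add_self: "x \<in> carrier_vec N \<Longrightarrow> x + x = (0\<^sub>v N :: bit vec)"
  by (intro eq_vecI) auto

lemma bit_vec_add_cancel:
  "x \<in> carrier_vec N \<Longrightarrow> y \<in> carrier_vec N \<Longrightarrow> x + y + y = (x :: bit vec)"
  by (intro eq_vecI) (auto simp: add.assoc)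

section \<open>Finite sums of vectors and the size of the ambient space\<close>

abbreviation sum_vecs :: "nat \<Rightarrow> bit vec set \<Rightarrow> bit vec" where
  "sum_vecs N D \<equiv> vec_sum N (\<lambda>y. y) D"

lemma vec_sum_carrier [simp]: "vec_sum N f S \<in> carrier_vec N"
  by (simp add: vec_sum_def)

lemma dim_vec_sum [simp]: "dim_vec (vec_sum N f S) = N"
  by (simp add: vec_sum_def)

lemma index_vec_sum [simp]: "i < N \<Longrightarrow> vec_sum N f S $ i = (\<Sum>s\<in>S. f s $ i)"
  by (simp add: vec_sum_def)

lemma vec_sum_closed:
  assumes "finite S" "0\<^sub>v N \<in> U" "U \<subseteq> carrier_vec N"
    and add: "\<And>x y. x \<in> U \<Longrightarrow> y \<in> U \<Longrightarrow> x + y \<in> U"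
    and "\<And>s. s \<in> S \<Longrightarrow> f s \<in> U"
  shows "vec_sum N f S \<in> U"
  using assms(1,5)
proof (induction S rule: finite_induct)
  case empty
  have "vec_sum N f {} = 0\<^sub>v N" by (intro eq_vecI) auto
  then show ?case using assms(2) by simp
next
  case (insert s S)
  have "f s \<in> carrier_vec N" using insert.prems assms(3) by blast
  then have "vec_sum N f (insert s S) = f s + vec_sum N f S"
    using insert.hyps by (intro eq_vecI) (auto dest: carrier_vecD)
  then show ?case using insert by (simp add: add)
qed

lemma bij_betw_indicator_vec:
  "bij_betw (\<lambda>D. vec N (\<lambda>i. of_bool (i \<in> D))) (Pow {..<N}) (carrier_vec N :: bit vec set)"
proof (rule bij_betw_byWitness[where f' = "\<lambda>x. {i. i < N \<and> x $ i = 1}"])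
  show "\<forall>x\<in>carrier_vec N. vec N (\<lambda>i. of_bool (i \<in> {i. i < N \<and> x $ i = 1})) = (x :: bit vec)"
    by (auto intro!: eq_vecI)
qed auto

lemma finite_bit_carrier_vec [simp]: "finite (carrier_vec N :: bit vec set)"
  using bij_betw_finite[OF bij_betw_indicator_vec] by simp

lemma card_bit_carrier_vec: "card (carrier_vec N :: bit vec set) = 2 ^ N"
  using bij_betw_same_card[OF bij_betw_indicator_vec, of N] by (simp add: card_Pow)

section \<open>Span and independence through subset sums\<close>

abbreviation (input) bit_span :: "nat \<Rightarrow> bit vec set \<Rightarrow> bit vec set" where
  "bit_span N \<equiv> LinearCombinations.module.span class_ring (module_vec TYPE(bit) N)"

abbreviation (input) bit_indpt :: "nat \<Rightarrow> bit vec set \<Rightarrow> bool" where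
  "bit_indpt N \<equiv> LinearCombinations.module.lin_indpt class_ring (module_vec TYPE(bit) N)"

context
  fixes N :: nat and B :: "bit vec set"
  assumes B: "B \<subseteq> carrier_vec N"
begin

interpretation V: vec_space "TYPE(bit)" N .

text \<open>A binary coefficient is 0 or 1, so it only selects whether a vector takes part in the
  sum.\<close>

lemma lincomb_eq_sum_vecs:
  assumes "A \<subseteq> B"
  shows "V.lincomb a A = sum_vecs N {x\<in>A. a x = 1}"
proof (intro eq_vecI)
  have A: "finite A" "A \<subseteq> carrier_vec N"
    using assms B finite_subset[OF _ finite_bit_carrier_vec] by blast+
  show "dim_vec (V.lincomb a A) = dim_vec (sum_vecs N {x\<in>A. a x = 1})"
    using V.lincomb_dim[OF A] by simp
  fix i assume "i < dim_vec (sum_vecs N {x\<in>A. a x = 1})"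
  then have i: "i < N" by simp
  have "(\<Sum>x\<in>A. a x * x $ i) = (\<Sum>x\<in>{x\<in>A. a x = 1}. x $ i)"
    using A(1) by (intro sum.mono_neutral_cong_right) auto
  then show "V.lincomb a A $ i = sum_vecs N {x\<in>A. a x = 1} $ i"
    using i V.lincomb_index[OF i A(2)] by simp
qed

lemma bit_span_eq: "bit_span N B = sum_vecs N ` Pow B"
proof -
  have fin: "finite A" if "A \<subseteq> B" for A
    using that B finite_subset[OF _ finite_bit_carrier_vec] by blast
  have "sum_vecs N D \<in> V.span B" if "D \<subseteq> B" for D
  proof -
    have "sum_vecs N D = V.lincomb (\<lambda>_. 1) D" 
      using lincomb_eq_sum_vecs[OF that, of "\<lambda>_. 1"] by simp
    then show ?thesis
      using that fin[OF that] unfolding V.span_def by blast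
  qed
  moreover have "V.span B \<subseteq> sum_vecs N ` Pow B"
    unfolding V.span_def by (auto simp: lincomb_eq_sum_vecs)
  ultimately show ?thesis by auto
qed

lemma bit_indpt_iff: "bit_indpt N B \<longleftrightarrow> (\<forall>D\<subseteq>B. sum_vecs N D = 0\<^sub>v N \<longrightarrow> D = {})"
proof -
  have fin: "finite A" if "A \<subseteq> B" for A
    using that B finite_subset[OF _ finite_bit_carrier_vec] by blast
  have "V.lin_dep B \<longleftrightarrow> (\<exists>D\<subseteq>B. sum_vecs N D = 0\<^sub>v N \<and> D \<noteq> {})"
  proof
    assume "V.lin_dep B"
    then obtain A a v where *: "A \<subseteq> B" "V.lincomb a A = 0\<^sub>v N" "v \<in> A" "a v \<noteq> 0"
      unfolding V.lin_dep_def by auto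
    then show "\<exists>D\<subseteq>B. sum_vecs N D = 0\<^sub>v N \<and> D \<noteq> {}"
      using lincomb_eq_sum_vecs[OF *(1), of a]
      by (intro exI[of _ "{x\<in>A. a x = 1}"]) auto
  next
    assume "\<exists>D\<subseteq>B. sum_vecs N D = 0\<^sub>v N \<and> D \<noteq> {}"
    then obtain D v where D: "D \<subseteq> B" "sum_vecs N D = 0\<^sub>v N" "v \<in> D" by auto
    have "sum_vecs N D = V.lincomb (\<lambda>_. 1) D" 
      using lincomb_eq_sum_vecs[OF D(1), of "\<lambda>_. 1"] by simp
    then show "V.lin_dep B"
      using D fin by (intro V.lin_dep_crit[where A = D and a = "\<lambda>_. 1" and v = v]) auto
  qed
  then show ?thesis by blast
qed

text \<open>Vectors common to \<open>D\<close> and \<open>E\<close> occur twice on the right and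
  cancel.\<close>

lemma sum_vecs_sym_diff:
  assumes "D \<subseteq> B" "E \<subseteq> B"
  shows "sum_vecs N (D - E \<union> (E - D)) = sum_vecs N D + sum_vecs N E"
proof (intro eq_vecI)
  have fin: "finite D" "finite E"
    using assms B finite_subset[OF _ finite_bit_carrier_vec] by blast+
  fix i assume "i < dim_vec (sum_vecs N D + sum_vecs N E)"
  then have i: "i < N" by simp
  have "(\<Sum>y\<in>D - E \<union> (E - D). y $ i) = (\<Sum>y\<in>D - E. y $ i) + (\<Sum>y\<in>E - D. y $ i)"
    using fin by (intro sum.union_disjoint) auto
  moreover have "(\<Sum>y\<in>D. y $ i) = (\<Sum>y\<in>D - E. y $ i) + (\<Sum>y\<in>D \<inter> E. y $ i)"
    using fin by (subst sum.union_disjoint[symmetric]) (auto intro: sum.cong)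
  moreover have "(\<Sum>y\<in>E. y $ i) = (\<Sum>y\<in>E - D. y $ i) + (\<Sum>y\<in>D \<inter> E. y $ i)"
    using fin by (subst sum.union_disjoint[symmetric]) (auto intro: sum.cong)
  ultimately show "sum_vecs N (D - E \<union> (E - D)) $ i = (sum_vecs N D + sum_vecs N E) $ i"
    using i by (simp add: ac_simps)
qed simp

text \<open>The subset-sum map from \<open>Pow B\<close> onto the span is injective exactly for
  independent \<open>B\<close>. This lets independence be proved by counting.\<close>

lemma bit_indpt_iff_card_span: "bit_indpt N B \<longleftrightarrow> card (bit_span N B) = 2 ^ card B"
proof -
  have fin: "finite B" using B finite_subset[OF _ finite_bit_carrier_vec] by blast
  have 0: "sum_vecs N {} = 0\<^sub>v N" by (intro eq_vecI) auto
  have "bit_indpt N B \<longleftrightarrow> inj_on (sum_vecs N) (Pow B)"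
  proof
    assume ind: "bit_indpt N B"
    show "inj_on (sum_vecs N) (Pow B)"
    proof (rule inj_onI)
      fix D E assume *: "D \<in> Pow B" "E \<in> Pow B" "sum_vecs N D = sum_vecs N E"
      then have "sum_vecs N (D - E \<union> (E - D)) = 0\<^sub>v N"
        using sum_vecs_sym_diff[of D E] by (simp add: bit_vec_add_self)
      moreover have "D - E \<union> (E - D) \<subseteq> B" using * by auto
      ultimately have "D - E \<union> (E - D) = {}" using ind bit_indpt_iff by blast
      then show "D = E" by auto
    qed
  next
    assume "inj_on (sum_vecs N) (Pow B)"
    then show "bit_indpt N B"
      unfolding bit_indpt_iff using 0 by (metis Pow_bottom PowI inj_onD)
  qed
  then show ?thesis
    using fin inj_on_iff_eq_card[of "Pow B" "sum_vecs N"] by (simp add: bit_span_eq card_Pow)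
qed

lemma bit_span_add:
  assumes "x \<in> bit_span N B" "y \<in> bit_span N B"
  shows "x + y \<in> bit_span N B"
proof -
  obtain D E where *: "D \<subseteq> B" "E \<subseteq> B" "x = sum_vecs N D" "y = sum_vecs N E"
    using assms by (auto simp: bit_span_eq)
  then have "x + y = sum_vecs N (D - E \<union> (E - D))" by (simp add: sum_vecs_sym_diff)
  moreover have "D - E \<union> (E - D) \<subseteq> B" using * by auto
  ultimately show ?thesis by (auto simp: bit_span_eq)
qed

lemma bit_span_base: "y \<in> B \<Longrightarrow> y \<in> bit_span N B"
proof -
  assume "y \<in> B"
  then have "y = sum_vecs N {y}" using B by (intro eq_vecI) auto
  then show ?thesis using \<open>y \<in> B\<close> unfolding bit_span_eq by blast
qed

lemma bit_span_vec_sum: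
  assumes "finite S" "\<And>s. s \<in> S \<Longrightarrow> f s \<in> bit_span N B"
  shows "vec_sum N f S \<in> bit_span N B"
proof (rule vec_sum_closed[OF assms(1)])
  have "sum_vecs N {} = 0\<^sub>v N" by (intro eq_vecI) auto
  then show "0\<^sub>v N \<in> bit_span N B" unfolding bit_span_eq by (metis Pow_bottom imageI)
  show "bit_span N B \<subseteq> carrier_vec N" by (auto simp: bit_span_eq)
qed (use assms bit_span_add in auto)

end

section \<open>Character sums and the dimension of a self-dual code\<close>

text \<open>Translation by \<open>y0\<close> permutes \<open>G\<close> and flips the sign of every
  term, so the sum equals its own negative.\<close>

lemma sum_character_eq_0:
  fixes x y0 :: "bit vec"
  assumes fin: "finite G" and G: "G \<subseteq> carrier_vec N"
    and add: "\<And>y z. y \<in> G \<Longrightarrow> z \<in> G \<Longrightarrow> y + z \<in> G"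
    and x: "x \<in> carrier_vec N" and y0: "y0 \<in> G" "x \<bullet> y0 = 1"
  shows "(\<Sum>y\<in>G. if x \<bullet> y = 0 then 1 else (-1::int)) = 0"
proof -
  let ?f = "\<lambda>y. if x \<bullet> y = 0 then 1 else (-1::int)"
  have "y + y0 + y0 = y" if "y \<in> G" for y
    using that G y0 by (intro bit_vec_add_cancel[of _ N]) auto
  then have "sum ?f G = (\<Sum>y\<in>G. ?f (y + y0))"
    using add y0
    by (intro sum.reindex_bij_witness[of _ "\<lambda>y. y + y0" "\<lambda>y. y + y0"]) auto
  also have "\<dots> = (\<Sum>y\<in>G. - ?f y)"
  proof (rule sum.cong)
    fix y assume "y \<in> G"
    then have "x \<bullet> (y + y0) = x \<bullet> y + 1"
      using G x y0 scalar_prod_add_distrib[of x N y y0] by auto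
    then show "?f (y + y0) = - ?f y" by (cases "x \<bullet> y") auto
  qed simp
  finally show ?thesis by (simp add: sum_negf)
qed

lemma dual_code_add:
  "y \<in> dual_code N C \<Longrightarrow> z \<in> dual_code N C \<Longrightarrow> C \<subseteq> carrier_vec N \<Longrightarrow> y + z \<in> dual_code N C"
  using add_scalar_prod_distrib[of y N z] by (auto simp: dual_code_def subset_iff)

text \<open>Double counting of the character sum \<open>\<Sum>\<^sub>x \<Sum>\<^sub>y (-1)\<^bsup>x\<bullet>y\<^esup>\<close>.\<close>

lemma card_self_dual:
  assumes "self_dual N C"
  shows "card C * card C = 2 ^ N"
proof -
  let ?W = "carrier_vec N :: bit vec set"
  let ?f = "\<lambda>x y. if x \<bullet> y = 0 then 1 else (-1::int)"
  have C: "C \<subseteq> ?W" and dual: "C = dual_code N C"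
    using assms by (auto simp: self_dual_def)
  have fin: "finite C" using C finite_subset finite_bit_carrier_vec by blast
  have add: "y + z \<in> C" if "y \<in> C" "z \<in> C" for y z
    using dual_code_add[of y N C z] that C dual by auto
  have zero: "0\<^sub>v N \<in> C"
    using C by (subst dual) (auto simp: dual_code_def)
  have inner: "(\<Sum>y\<in>C. ?f x y) = (if x \<in> C then int (card C) else 0)" if xW: "x \<in> ?W" for x
  proof (cases "x \<in> C")
    case True
    then have "(\<Sum>y\<in>C. ?f x y) = (\<Sum>y\<in>C. 1)"
      using dual by (intro sum.cong) (auto simp: dual_code_def)
    then show ?thesis using True by simp
  next
    case False
    then have "x \<notin> dual_code N C" using dual by simp
    then obtain y0 where "y0 \<in> C" "x \<bullet> y0 = 1"
      using xW by (auto simp: dual_code_def)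
    then have "(\<Sum>y\<in>C. ?f x y) = 0"
      using fin C add xW by (intro sum_character_eq_0)
    then show ?thesis using False by simp
  qed
  have outer: "(\<Sum>x\<in>?W. ?f x y) = (if y = 0\<^sub>v N then 2 ^ N else 0)" if yW: "y \<in> ?W" for y
  proof (cases "y = 0\<^sub>v N")
    case True
    then show ?thesis by (simp add: card_bit_carrier_vec)
  next
    case False
    \<comment> \<open>The unit vector at a nonzero entry of \<open>y\<close> witnesses that the
      character given by \<open>y\<close> is nontrivial on the whole space.\<close>
    then obtain i where "i < N" "y $ i = 1"
      using yW by (auto simp: vec_eq_iff)
    then have "y \<bullet> unit_vec N i = 1" using yW by simp
    then have "(\<Sum>x\<in>?W. ?f y x) = 0"
      using that by (intro sum_character_eq_0[of ?W N y "unit_vec N i"]) auto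
    moreover have "(\<Sum>x\<in>?W. ?f y x) = (\<Sum>x\<in>?W. ?f x y)"
      using that by (intro sum.cong) (auto simp: comm_scalar_prod[of y N])
    ultimately show ?thesis using False by simp
  qed
  have "int (card C * card C) = (\<Sum>x\<in>?W. if x \<in> C then int (card C) else 0)"
    using C by (simp add: sum.If_cases Int_absorb1)
  also have "\<dots> = (\<Sum>x\<in>?W. \<Sum>y\<in>C. ?f x y)"
    by (intro sum.cong) (simp_all add: inner)
  also have "\<dots> = (\<Sum>y\<in>C. \<Sum>x\<in>?W. ?f x y)"
    by (rule sum.swap)
  also have "\<dots> = (\<Sum>y\<in>C. if y = 0\<^sub>v N then 2 ^ N else 0)"
    using C by (intro sum.cong outer) auto
  also have "\<dots> = 2 ^ N"
    using fin zero by simp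
  finally show ?thesis
    by (metis of_nat_eq_iff of_nat_numeral of_nat_power)
qed

lemma card_code_basis:
  assumes "self_dual N C" "B \<in> code_bases N C"
  shows "2 * card B = N"
proof -
  have "B \<subseteq> carrier_vec N" "card C = 2 ^ card B"
    using assms bit_indpt_iff_card_span[of B N] by (auto simp: self_dual_def code_bases_def)
  then have "(2::nat) ^ (2 * card B) = 2 ^ N"
    using card_self_dual[OF assms(1)] by (simp add: power_add mult_2)
  then show ?thesis by simp
qed

text \<open>Reduces every change of basis below to recovering the old vectors from the new ones;
  independence and injectivity then follow by counting.\<close>

lemma code_bases_basis_change:
  assumes sd: "self_dual N C" and B: "B \<in> code_bases N C"
    and gC: "g ` B \<subseteq> C" and span: "B \<subseteq> bit_span N (g ` B)"
  shows "g ` B \<in> code_bases N C" "inj_on g B"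
proof -
  have C: "C \<subseteq> carrier_vec N" and dual: "C = dual_code N C"
    using sd by (auto simp: self_dual_def)
  have BN: "B \<subseteq> carrier_vec N" and gN: "g ` B \<subseteq> carrier_vec N"
    using B C gC by (auto simp: code_bases_def)
  have fin: "finite B" using BN finite_subset[OF _ finite_bit_carrier_vec] by blast
  have zero: "0\<^sub>v N \<in> C"
    using C by (subst dual) (auto simp: dual_code_def)
  have add: "y + z \<in> C" if "y \<in> C" "z \<in> C" for y z
    using dual_code_add[of y N C z] that C dual by auto
  have "sum_vecs N D \<in> C" if "D \<subseteq> g ` B" for D
    using that fin gC zero C add finite_subset[of D "g ` B"]
    by (intro vec_sum_closed) auto
  then have "bit_span N (g ` B) \<subseteq> C"
    by (auto simp: bit_span_eq[OF gN])
  moreover have "sum_vecs N D \<in> bit_span N (g ` B)" if "D \<subseteq> B" for D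
    using that span fin finite_subset[of D B] by (intro bit_span_vec_sum[OF gN]) auto
  then have "bit_span N B \<subseteq> bit_span N (g ` B)"
    by (auto simp: bit_span_eq[OF BN])
  then have "C \<subseteq> bit_span N (g ` B)"
    using B by (simp add: code_bases_def)
  ultimately have gspan: "bit_span N (g ` B) = C" by auto
  have cardC: "card C = 2 ^ card B"
    using B bit_indpt_iff_card_span[OF BN] by (auto simp: code_bases_def)
  \<comment> \<open>The span is the image of \<open>Pow (g\<close> B)\<open>, so\<close>g
    \<open>B\<close> has at least as many vectors as \<open>B\<close>.\<close>
  have "card C \<le> card (Pow (g ` B))"
    using fin card_image_le[of "Pow (g ` B)" "sum_vecs N"]
    by (simp add: gspan bit_span_eq[OF gN, symmetric])
  then have "card B \<le> card (g ` B)"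
    using fin by (simp add: cardC card_Pow)
  then have card: "card (g ` B) = card B"
    using card_image_le[OF fin, of g] by simp
  then show "inj_on g B" using fin by (rule eq_card_imp_inj_on[rotated])
  have "bit_indpt N (g ` B)"
    by (simp add: bit_indpt_iff_card_span[OF gN] gspan cardC card)
  then show "g ` B \<in> code_bases N C"
    using gC gspan by (simp add: code_bases_def)
qed

section \<open>Gram-type matrices, their products and inverses\<close>

text \<open>Only the first \<open>n\<close> coordinates of each vector enter. The family is indexed
  rather than a set, so that repeated vectors count with multiplicity.\<close>

definition gram :: "nat \<Rightarrow> 'b set \<Rightarrow> ('b \<Rightarrow> bit vec) \<Rightarrow> bit mat" where
  "gram n S f = mat n n (\<lambda>(i,j). of_bool (i = j) + (\<Sum>s\<in>S. f s $ i * f s $ j))"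

lemma gram_carrier [simp]: "gram n S f \<in> carrier_mat n n"
  by (simp add: gram_def)

lemma index_vsq: "i < dim_vec x \<Longrightarrow> j < dim_vec x \<Longrightarrow> vsq x $$ (i,j) = x $ i * x $ j"
  by (simp add: vsq_def scalar_prod_def mat_of_cols_index)

lemma dim_vsq [simp]: "dim_row (vsq x) = dim_vec x" "dim_col (vsq x) = dim_vec x"
  by (simp_all add: vsq_def)

lemma A1_eq_gram: "A1 n B = gram n B (\<lambda>y. y)"
  by (intro eq_matI) (auto simp: A1_def gram_def mat_sum_def index_vsq vec_first_def)

text \<open>The index \<open>None\<close> carries the extra summand of A'', kept apart from the
  basis even if the sum coincides with a basis vector.\<close>

lemma A2_eq_gram:
  assumes "finite B" "n < N"
  shows "A2 n B = gram n (insert None (Some ` B)) (case_option (sum_vecs N B) (\<lambda>y. y))"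
  using assms
  by (intro eq_matI)
    (auto simp: A2_def gram_def mat_sum_def index_vsq vec_first_def sum.reindex ac_simps)

text \<open>Entrywise form of the product formula: orthogonality in all \<open>N\<close> coordinates
  replaces each inner product of shortened vectors by a product of last entries, and the double sum
  then factors.\<close>

lemma gram_mult_index:
  assumes fin: "finite S" "finite T" and N: "N = Suc n"
    and f: "\<And>s. s \<in> S \<Longrightarrow> f s \<in> carrier_vec N" and h: "\<And>t. t \<in> T \<Longrightarrow> h t \<in> carrier_vec N"
    and orth: "\<And>s t. s \<in> S \<Longrightarrow> t \<in> T \<Longrightarrow> f s \<bullet> h t = 0"
    and ij: "i < n" "j < n"
  shows "(gram n S f * gram n T h) $$ (i,j) =
    of_bool (i = j) + (\<Sum>s\<in>S. f s $ i * f s $ j) + (\<Sum>t\<in>T. h t $ i * h t $ j)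
      + (\<Sum>s\<in>S. f s $ i * f s $ n) * (\<Sum>t\<in>T. h t $ n * h t $ j)"
proof -
  let ?F = "\<lambda>i j. \<Sum>s\<in>S. f s $ i * f s $ j" and ?H = "\<lambda>i j. \<Sum>t\<in>T. h t $ i * h t $ j"
  \<comment> \<open>The full product vanishes, and in characteristic 2 the last term moves across
    without a sign.\<close>
  have dot: "(\<Sum>k<n. f s $ k * h t $ k) = f s $ n * h t $ n" if "s \<in> S" "t \<in> T" for s t
  proof -
    have "(\<Sum>k<n. f s $ k * h t $ k) + f s $ n * h t $ n = 0"
      using orth[OF that] h[OF that(2)] N by (simp add: scalar_prod_def atLeast0LessThan)
    then show ?thesis by (metis add.right_neutral bit_add_self_left add.commute)
  qed
  have "(\<Sum>k<n. ?F i k * ?H k j) = (\<Sum>k<n. \<Sum>s\<in>S. \<Sum>t\<in>T. (f s $ i * h t $ j) * (f s $ k * h t $ k))"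
    by (simp add: sum_product mult_ac)
  also have "\<dots> = (\<Sum>s\<in>S. \<Sum>k<n. \<Sum>t\<in>T. (f s $ i * h t $ j) * (f s $ k * h t $ k))"
    by (rule sum.swap)
  also have "\<dots> = (\<Sum>s\<in>S. \<Sum>t\<in>T. \<Sum>k<n. (f s $ i * h t $ j) * (f s $ k * h t $ k))"
    by (intro sum.cong sum.swap refl)
  also have "\<dots> = (\<Sum>s\<in>S. \<Sum>t\<in>T. (f s $ i * h t $ j) * (f s $ n * h t $ n))"
    by (intro sum.cong refl) (simp add: dot flip: sum_distrib_left)
  also have "\<dots> = ?F i n * ?H n j"
    by (simp add: sum_product mult_ac)
  finally have FH: "(\<Sum>k<n. ?F i k * ?H k j) = ?F i n * ?H n j" .
  have "(gram n S f * gram n T h) $$ (i,j) =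
      (\<Sum>k<n. (of_bool (i = k) + ?F i k) * (of_bool (k = j) + ?H k j))"
    using ij by (simp add: gram_def scalar_prod_def atLeast0LessThan)
  also have "\<dots> = (\<Sum>k<n. of_bool (i = k) * of_bool (k = j)) + (\<Sum>k<n. of_bool (i = k) * ?H k j)
      + (\<Sum>k<n. ?F i k * of_bool (k = j)) + (\<Sum>k<n. ?F i k * ?H k j)"
    by (simp only: distrib_left distrib_right sum.distrib ac_simps)
  also have "(\<Sum>k<n. of_bool (i = k) * of_bool (k = j)) = (of_bool (i = j) :: bit)"
    using ij by (simp add: of_bool_def if_distrib[of "\<lambda>x. x * _"] cong: if_cong)
  also have "(\<Sum>k<n. of_bool (i = k) * ?H k j) = ?H i j"
    using ij by (simp add: of_bool_def if_distrib[of "\<lambda>x. x * _"] cong: if_cong)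
  also have "(\<Sum>k<n. ?F i k * of_bool (k = j)) = ?F i j"
    using ij by (simp add: of_bool_def if_distrib[of "\<lambda>x. _ * x"] cong: if_cong)
  finally show ?thesis by (simp only: FH add_ac)
qed

text \<open>For square matrices a right inverse is two-sided. Hence \<open>A\<close> is a unit,
  \<open>mat_inverse A\<close> is not \<open>None\<close>, and uniqueness identifies it with
  \<open>X\<close>.\<close>

lemma mat_inv_eqI:
  assumes A: "A \<in> carrier_mat n n" and X: "X \<in> carrier_mat n n" and AX: "A * X = 1\<^sub>m n"
  shows "mat_inv A = X"
proof -
  have XA: "X * A = 1\<^sub>m n" using mat_mult_left_right_inverse[OF A X AX] .
  then have "A \<in> Units (ring_mat TYPE(bit) n undefined)"
    using A X AX by (auto simp: Units_def ring_mat_simps)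
  then obtain Y where Y: "mat_inverse A = Some Y"
    using mat_inverse(1)[OF A] by fastforce
  then have AY: "A * Y = 1\<^sub>m n" "Y \<in> carrier_mat n n"
    using mat_inverse(2)[OF A] by auto
  have "Y = (X * A) * Y" using XA AY by simp
  also have "\<dots> = X * (A * Y)" using A X AY by simp
  also have "\<dots> = X" using X AY by simp
  finally show ?thesis using Y by (simp add: mat_inv_def)
qed

section \<open>Bases of a self-dual code and the inverse of A'\<close>

text \<open>Index \<open>n\<close> is the last coordinate, the one deleted in shortened
  vectors.\<close>

locale self_dual_code =
  fixes n N :: nat and C :: "bit vec set"
  assumes N: "N = Suc n" and sd: "self_dual N C"
begin

lemma C_carrier: "x \<in> C \<Longrightarrow> x \<in> carrier_vec N"
  using sd by (auto simp: self_dual_def)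

lemma C_orth: "x \<in> C \<Longrightarrow> y \<in> C \<Longrightarrow> x \<bullet> y = 0"
  using sd unfolding self_dual_def dual_code_def by blast

lemma C_dual: "x \<in> carrier_vec N \<Longrightarrow> (\<And>y. y \<in> C \<Longrightarrow> x \<bullet> y = 0) \<Longrightarrow> x \<in> C"
  using sd unfolding self_dual_def dual_code_def by blast

lemma C_add: "x \<in> C \<Longrightarrow> y \<in> C \<Longrightarrow> x + y \<in> C"
  using sd dual_code_add unfolding self_dual_def by metis

lemma C_zero: "0\<^sub>v N \<in> C"
  by (rule C_dual) (auto dest: C_carrier)

lemma C_sum:
  assumes "finite S" "S \<subseteq> C"
  shows "sum_vecs N S \<in> C"
  using assms C_zero C_carrier C_add by (intro vec_sum_closed) auto

lemma finite_C: "finite C"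
  using C_carrier finite_subset[OF _ finite_bit_carrier_vec] by blast

lemma basis_subset: "B \<in> code_bases N C \<Longrightarrow> B \<subseteq> C"
  by (simp add: code_bases_def)

lemma finite_basis: "B \<in> code_bases N C \<Longrightarrow> finite B"
  using basis_subset finite_C finite_subset by blast

lemma code_bases2_iff:
  "B \<in> code_bases2 N C \<longleftrightarrow> B \<in> code_bases N C \<and> (\<Sum>y\<in>B. y $ n) = 0"
  using sum_bit_eq_parity[of B "\<lambda>y. y $ n"] finite_basis[of B]
  by (auto simp: code_bases2_def N)

text \<open>Otherwise the last unit vector is orthogonal to all of \<open>C\<close>, hence lies in
  \<open>C\<close>, yet its product with itself is 1.\<close>

lemma ex_last_entry_1:
  assumes B: "B \<in> code_bases N C"
  shows "\<exists>y\<in>B. y $ n = 1"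
proof (rule ccontr)
  assume "\<not> (\<exists>y\<in>B. y $ n = 1)"
  then have zero: "y $ n = 0" if "y \<in> B" for y using that by auto
  have "x $ n = 0" if "x \<in> C" for x
  proof -
    have "C = bit_span N B" using B by (simp add: code_bases_def)
    also have "\<dots> = sum_vecs N ` Pow B"
      using basis_subset[OF B] C_carrier by (intro bit_span_eq) auto
    finally obtain D where "D \<subseteq> B" "x = sum_vecs N D" using \<open>x \<in> C\<close> by auto
    then show ?thesis using zero N by (auto intro!: sum.neutral)
  qed
  then have "unit_vec N n \<bullet> x = 0" if "x \<in> C" for x
    using that C_carrier[OF that] N by simp
  then have u: "unit_vec N n \<in> C" by (intro C_dual) auto
  show False using C_orth[OF u u] N by simp
qed

text \<open>The extra vector of A'' has last entry \<open>card B\<close> modulo 2, that is 0, so it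
  does not enter the correction term of the product. That term becomes the square of the basis sum
  and cancels the extra summand of A''.\<close>

lemma A1_mult_A2_eq_1:
  assumes B: "B \<in> code_bases N C" and ones: "\<And>y. y \<in> B \<Longrightarrow> y $ n = 1" and even: "even (card B)"
  shows "A1 n B * A2 n B = 1\<^sub>m n"
proof (rule eq_matI)
  note fin = finite_basis[OF B]
  have BC: "B \<subseteq> C" using basis_subset[OF B] .
  have S: "sum_vecs N B \<in> C" using C_sum[OF fin BC] .
  fix i j assume "i < dim_row (1\<^sub>m n :: bit mat)" "j < dim_col (1\<^sub>m n :: bit mat)"
  then have ij: "i < n" "j < n" by auto
  have \<sigma>: "(\<Sum>y\<in>B. y $ i * y $ n) = (\<Sum>y\<in>B. y $ i)" "(\<Sum>y\<in>B. y $ n * y $ j) = (\<Sum>y\<in>B. y $ j)"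
    "(\<Sum>y\<in>B. y $ n) = 0"
    using even by (simp_all add: ones of_nat_bit)
  have "(A1 n B * A2 n B) $$ (i,j) = of_bool (i = j) + (\<Sum>y\<in>B. y $ i * y $ j)
      + ((\<Sum>y\<in>B. y $ i) * (\<Sum>y\<in>B. y $ j) + (\<Sum>y\<in>B. y $ i * y $ j))
      + (\<Sum>y\<in>B. y $ i) * (\<Sum>y\<in>B. y $ j)"
    unfolding A1_eq_gram using fin N ij BC S C_carrier C_orth
    by (subst A2_eq_gram[of _ _ N], simp, simp, subst gram_mult_index[of _ _ N])
      (auto simp: sum.reindex \<sigma> less_Suc_eq subset_iff)
  also have "\<dots> = of_bool (i = j)" by (simp add: add_ac)
  finally show "(A1 n B * A2 n B) $$ (i,j) = 1\<^sub>m n $$ (i,j)" using ij by simp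
qed (auto simp: A1_def A2_def mat_sum_def)

text \<open>Write \<open>P = I + X\<close> with \<open>X = e_k v^T + v e_k^T\<close>. Even weight of
  \<open>v\<close> and \<open>v_k = 0\<close> give \<open>X^2 = v v^T\<close>, hence
  \<open>P^T P = I + v v^T\<close>. They also give \<open>P v = v\<close>, so the parity condition
  survives.\<close>

lemma ex_A1_mult_A1_eq_1:
  assumes B: "B \<in> code_bases2 N C" and k: "k \<in> B" "k $ n = 0"
  obtains B' where "B' \<in> code_bases2 N C" "A1 n B * A1 n B' = 1\<^sub>m n"
proof -
  have Bb: "B \<in> code_bases N C" and par: "(\<Sum>y\<in>B. y $ n) = 0"
    using B by (auto simp: code_bases2_iff)
  note fin = finite_basis[OF Bb]
  have BC: "B \<subseteq> C" using basis_subset[OF Bb] .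
  \<comment> \<open>The vector \<open>v^T [H | v]\<close>; its last entry is the weight of
    \<open>v\<close> modulo 2, which is 0.\<close>
  define s where "s = sum_vecs N {y\<in>B. y $ n = 1}"
  have sC: "s \<in> C" unfolding s_def using fin BC by (intro C_sum) auto
  have s: "s $ i = (\<Sum>y\<in>B. y $ n * y $ i)" if "i < N" for i
    unfolding s_def using that fin by (simp, intro sum.mono_neutral_cong_left) auto
  have sn: "s $ n = 0" using s[of n] N par by simp
  \<comment> \<open>the rows of \<open>P [H | v]\<close> for \<open>P = I + e\<^sub>k v\<^sup>T + v e\<^sub>k\<^sup>T\<close>\<close>
  define g where "g y = (if y = k then k + s else if y $ n = 1 then y + k else y)" for y
  have gC: "g y \<in> C" if "y \<in> B" for y
    using that BC k sC C_add by (auto simp: g_def)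
  have g: "g y $ i = y $ i + y $ n * k $ i + of_bool (y = k) * s $ i" if "y \<in> B" "i < N" for y i
    using that k sC BC C_carrier[of k] C_carrier[of s] by (auto simp: g_def)
  have gn: "g y $ n = y $ n" if "y \<in> B" for y
    using g[OF that] N k sn by simp
  have gN: "g ` B \<subseteq> carrier_vec N" using gC C_carrier by auto
  have \<delta>: "(\<Sum>y\<in>B. of_bool (y = k) * f y) = f k" for f :: "bit vec \<Rightarrow> bit"
    using fin k by (simp add: of_bool_def if_distrib[of "\<lambda>x. x * _"] cong: if_cong)
  have dist: "b * (a + b * c + d * e) = b * a + b * c + d * (b * e)" for a b c d e :: bit
    by (cases b) simp_all
  \<comment> \<open>Evenly many vectors have last entry 1, so the added copies of \<open>k\<close>
    cancel, and \<open>k\<close> is not one of them. From \<open>s\<close> one recovers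
    \<open>k\<close>, and from \<open>k\<close> all other old vectors.\<close>
  have "s = vec_sum N g {y\<in>B. y $ n = 1}"
  proof (rule eq_vecI)
    fix i assume "i < dim_vec (vec_sum N g {y\<in>B. y $ n = 1})"
    then have i: "i < N" by simp
    have "(\<Sum>y\<in>{y\<in>B. y $ n = 1}. g y $ i) = (\<Sum>y\<in>B. y $ n * g y $ i)"
      using fin by (intro sum.mono_neutral_cong_left) auto
    also have "\<dots> = (\<Sum>y\<in>B. y $ n * y $ i + y $ n * k $ i + of_bool (y = k) * (y $ n * s $ i))"
      using i by (intro sum.cong refl) (simp only: g dist)
    also have "\<dots> = s $ i"
      using i by (simp only: sum.distrib \<delta> s k) (simp add: par flip: sum_distrib_right)
    finally show "s $ i = vec_sum N g {y\<in>B. y $ n = 1} $ i" using i by simp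
  qed (simp add: s_def)
  then have sS: "s \<in> bit_span N (g ` B)"
    using fin bit_span_base[OF gN] by (auto intro!: bit_span_vec_sum[OF gN])
  have "k = g k + s" using k BC sC C_carrier by (auto simp: g_def bit_vec_add_cancel[of _ N] subset_iff)
  then have kS: "k \<in> bit_span N (g ` B)"
    using bit_span_add[OF gN bit_span_base[OF gN] sS] k by (metis imageI)
  have "B \<subseteq> bit_span N (g ` B)"
  proof
    fix y assume y: "y \<in> B"
    have gy: "g y \<in> bit_span N (g ` B)" using bit_span_base[OF gN] y by auto
    have "y = g y + k" if "y \<noteq> k" "y $ n = 1"
      using that y k BC C_carrier by (auto simp: g_def bit_vec_add_cancel[of _ N] subset_iff)
    moreover have "y = g y" if "y \<noteq> k" "y $ n \<noteq> 1" using that by (simp add: g_def)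
    ultimately show "y \<in> bit_span N (g ` B)"
      using bit_span_add[OF gN gy kS] gy kS by metis
  qed
  then have gb: "g ` B \<in> code_bases N C" and inj: "inj_on g B"
    using code_bases_basis_change[OF sd Bb, of g] gC by auto
  show ?thesis
  proof
    show "g ` B \<in> code_bases2 N C"
      using gb par by (simp add: code_bases2_iff sum.reindex[OF inj] gn)
    show "A1 n B * A1 n (g ` B) = 1\<^sub>m n"
    proof (rule eq_matI)
      fix i j assume "i < dim_row (1\<^sub>m n :: bit mat)" "j < dim_col (1\<^sub>m n :: bit mat)"
      then have ij: "i < n" "j < n" by auto
      then have ijN: "i < N" "j < N" using N by auto
      have s': "(\<Sum>y\<in>B. y $ i * y $ n) = s $ i"
        using s[OF ijN(1)] by (simp add: mult_ac)
      have "(\<Sum>y\<in>B. g y $ n * g y $ j)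
          = (\<Sum>y\<in>B. y $ n * y $ j + y $ n * k $ j + of_bool (y = k) * (y $ n * s $ j))"
        using ijN by (intro sum.cong refl) (simp only: g gn dist)
      also have "\<dots> = s $ j"
        using ijN by (simp only: sum.distrib \<delta> s k) (simp add: par flip: sum_distrib_right)
      finally have gs: "(\<Sum>y\<in>B. g y $ n * g y $ j) = s $ j" .
      \<comment> \<open>Here \<open>b\<close> stands for \<open>y $ n\<close> and \<open>d\<close>
        for the indicator of \<open>y = k\<close>. Idempotence makes the product linear in each, so
        the sum over \<open>B\<close> splits into known sums.\<close>
      have expand: "(a + b * c + d * e) * (a' + b * c' + d * e')
          = a * a' + (b * a) * c' + (b * a') * c + b * (c * c')
            + d * (a * e' + a' * e + e * e' + b * (c * e' + c' * e))" for a a' b c c' d e e' :: bit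
        by (cases b; cases d) (simp_all add: algebra_simps)
      have "(\<Sum>y\<in>B. g y $ i * g y $ j)
          = (\<Sum>y\<in>B. y $ i * y $ j + (y $ n * y $ i) * k $ j + (y $ n * y $ j) * k $ i
              + y $ n * (k $ i * k $ j)
              + of_bool (y = k) * (y $ i * s $ j + y $ j * s $ i + s $ i * s $ j
                  + y $ n * (k $ i * s $ j + k $ j * s $ i)))"
        using ijN by (intro sum.cong refl) (simp only: g expand)
      also have "\<dots> = (\<Sum>y\<in>B. y $ i * y $ j) + s $ i * k $ j + s $ j * k $ i
          + (k $ i * s $ j + k $ j * s $ i + s $ i * s $ j)"
        by (simp only: sum.distrib \<delta> k s[OF ijN(1)] s[OF ijN(2)])
          (simp add: par flip: sum_distrib_right)
      also have "\<dots> = (\<Sum>y\<in>B. y $ i * y $ j) + s $ i * s $ j"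
        by (simp add: ac_simps)
      finally have gg: "(\<Sum>y\<in>B. g y $ i * g y $ j) = (\<Sum>y\<in>B. y $ i * y $ j) + s $ i * s $ j" .
      have "(A1 n B * A1 n (g ` B)) $$ (i,j) = of_bool (i = j) + (\<Sum>y\<in>B. y $ i * y $ j)
          + ((\<Sum>y\<in>B. y $ i * y $ j) + s $ i * s $ j) + s $ i * s $ j"
        unfolding A1_eq_gram using fin N ij BC gC C_carrier C_orth
        by (subst gram_mult_index[of _ _ N])
          (auto simp: sum.reindex[OF inj] s' gs gg subset_iff)
      also have "\<dots> = of_bool (i = j)" by (simp add: add_ac)
      finally show "(A1 n B * A1 n (g ` B)) $$ (i,j) = 1\<^sub>m n $$ (i,j)" using ij by simp
    qed (auto simp: A1_def mat_sum_def)
  qed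
qed

section \<open>Transvections fixing A''\<close>

text \<open>With \<open>a\<close> the indicator vector of \<open>D\<close> and \<open>S = I + J\<close>, the base change is the transvection
  \<open>I + a (S a)\<^sup>T\<close>; as \<open>D\<close> is odd, \<open>S a\<close> is the indicator vector of \<open>B - D\<close>.\<close>

lemma ex_transvection:
  assumes B: "B \<in> code_bases N C" and D: "D \<subseteq> B" "odd (card D)"
  obtains g where "inj_on g B" "g ` B \<in> code_bases N C" "A2 n (g ` B) = A2 n B"
    "\<And>y. y \<in> B \<Longrightarrow> g y $ n = y $ n + of_bool (y \<in> D) * (\<Sum>y\<in>B - D. y $ n)"
proof -
  note fin = finite_basis[OF B]
  have BC: "B \<subseteq> C" using basis_subset[OF B] .
  \<comment> \<open>This is \<open>(S a)^T\<close> applied to the rows; the transvection adds it to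
    the rows indexed by \<open>D\<close>.\<close>
  define z where "z = sum_vecs N (B - D)"
  have zC: "z \<in> C" unfolding z_def using fin BC by (intro C_sum) auto
  define g where "g y = (if y \<in> D then y + z else y)" for y
  have gC: "g y \<in> C" if "y \<in> B" for y
    using that BC zC C_add by (auto simp: g_def)
  have g: "g y $ i = y $ i + of_bool (y \<in> D) * z $ i" if "y \<in> B" "i < N" for y i
    using that zC C_carrier[of z] by (auto simp: g_def)
  have gN: "g ` B \<subseteq> carrier_vec N" using gC C_carrier by auto
  \<comment> \<open>Vectors outside \<open>D\<close> do not move, so \<open>z\<close> stays
    available for undoing the change.\<close>
  have "z = vec_sum N g (B - D)" by (intro eq_vecI) (auto simp: z_def g_def)
  then have zS: "z \<in> bit_span N (g ` B)"
    using fin bit_span_base[OF gN] by (auto intro!: bit_span_vec_sum[OF gN])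
  have "B \<subseteq> bit_span N (g ` B)"
  proof
    fix y assume y: "y \<in> B"
    have gy: "g y \<in> bit_span N (g ` B)" using bit_span_base[OF gN] y by auto
    have "y = g y + z" if "y \<in> D"
      using that y zC BC C_carrier by (auto simp: g_def bit_vec_add_cancel[of _ N] subset_iff)
    moreover have "y = g y" if "y \<notin> D" using that by (simp add: g_def)
    ultimately show "y \<in> bit_span N (g ` B)"
      using bit_span_add[OF gN gy zS] gy by metis
  qed
  then have gb: "g ` B \<in> code_bases N C" and inj: "inj_on g B"
    using code_bases_basis_change[OF sd B, of g] gC by auto
  have \<delta>: "(\<Sum>y\<in>B. of_bool (y \<in> D) * f y) = (\<Sum>y\<in>D. f y)" for f :: "bit vec \<Rightarrow> bit"
    using fin D(1) by (intro sum.mono_neutral_cong_right) auto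
  have odd: "(of_nat (card D) :: bit) = 1" using D(2) by (simp add: of_nat_bit)
  have split: "(\<Sum>y\<in>B. y $ i) = (\<Sum>y\<in>D. y $ i) + z $ i" if "i < N" for i
    using that sum.subset_diff[OF D(1) fin] by (simp add: z_def add.commute)
  have "A2 n (g ` B) = A2 n B"
  proof (rule eq_matI)
    fix i j assume "i < dim_row (A2 n B)" "j < dim_col (A2 n B)"
    then have ij: "i < n" "j < n" by (auto simp: A2_def mat_sum_def)
    then have ijN: "i < N" "j < N" using N by auto
    \<comment> \<open>The old total is the sum over \<open>D\<close> plus \<open>z\<close>; an odd
      number of additions of \<open>z\<close> removes that \<open>z\<close>.\<close>
    have gsum: "(\<Sum>y\<in>B. g y $ i) = (\<Sum>y\<in>D. y $ i)" if "i < N" for i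
      using that by (simp add: g sum.distrib \<delta> odd split add.assoc)
    have expand: "(a + d * c) * (a' + d * c') = a * a' + d * (a * c' + a' * c + c * c')"
      for a a' c c' d :: bit
      by (cases d) (simp_all add: algebra_simps)
    have gg: "(\<Sum>y\<in>B. g y $ i * g y $ j) = (\<Sum>y\<in>B. y $ i * y $ j)
        + ((\<Sum>y\<in>D. y $ i) * z $ j + (\<Sum>y\<in>D. y $ j) * z $ i + z $ i * z $ j)"
      using ijN by (simp add: g expand sum.distrib \<delta> odd sum_distrib_right)
    \<comment> \<open>With \<open>p\<close> the sum over \<open>D\<close>, the total changes from
      \<open>p + z\<close> to \<open>p\<close>. Its square loses exactly the three terms that
      \<open>gg\<close> adds.\<close>
    show "A2 n (g ` B) $$ (i,j) = A2 n B $$ (i,j)"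
      using ij ijN fin N
      by (simp add: A2_eq_gram[of _ _ N] gram_def sum.reindex inj gsum gg split)
        (simp add: algebra_simps)
  qed (auto simp: A2_def mat_sum_def)
  then show ?thesis
    using that[OF inj gb] g N by (simp add: z_def)
qed

text \<open>Take \<open>D\<close> to be the vectors with last entry 0. Its size is even minus odd,
  and the vectors outside \<open>D\<close> have last entries summing to 1, so the transvection turns
  exactly the zeros into ones.\<close>

lemma ex_A2_eq_ones_if_odd:
  assumes B: "B \<in> code_bases N C" and even: "even (card B)" and odd: "(\<Sum>y\<in>B. y $ n) = 1"
  obtains B' where "B' \<in> code_bases N C" "A2 n B' = A2 n B" "\<And>y. y \<in> B' \<Longrightarrow> y $ n = 1"
proof -
  note fin = finite_basis[OF B]
  define D where "D = {y\<in>B. y $ n = 0}"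
  have BD: "B - D = {y\<in>B. y $ n = 1}" by (auto simp: D_def)
  have "odd (card (B - D))"
    using sum_bit_eq_parity[OF fin, of "\<lambda>y. y $ n"] odd by (simp add: BD split: if_splits)
  moreover have DB: "D \<subseteq> B" by (auto simp: D_def)
  ultimately have "odd (card D)"
    using even fin card_Diff_subset[of D B] card_mono[of B D] finite_subset[of D B] by auto
  then obtain g where g: "inj_on g B" "g ` B \<in> code_bases N C" "A2 n (g ` B) = A2 n B"
    "\<And>y. y \<in> B \<Longrightarrow> g y $ n = y $ n + of_bool (y \<in> D) * (\<Sum>y\<in>B - D. y $ n)"
    using ex_transvection[OF B DB] by blast
  have "(\<Sum>y\<in>B - D. y $ n) = 1"
    using \<open>odd (card (B - D))\<close> by (simp add: BD of_nat_bit)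
  then have "g y $ n = 1" if "y \<in> B" for y
    using g(4)[OF that] that by (cases "y $ n") (auto simp: D_def)
  then show ?thesis using that[OF g(2,3)] by auto
qed

text \<open>For even weight, a first transvection reduces the last column to a single 1, which leads
  to the odd case.\<close>

lemma ex_A2_eq_ones:
  assumes B: "B \<in> code_bases N C" and even: "even (card B)"
  obtains B' where "B' \<in> code_bases N C" "A2 n B' = A2 n B" "\<And>y. y \<in> B' \<Longrightarrow> y $ n = 1"
proof (cases "(\<Sum>y\<in>B. y $ n) = 1")
  case True
  then show ?thesis using ex_A2_eq_ones_if_odd[OF B even] that by blast
next
  case False
  note fin = finite_basis[OF B]
  obtain y0 where y0: "y0 \<in> B" "y0 $ n = 1" using ex_last_entry_1[OF B] by blast
  \<comment> \<open>Leaving out one vector makes \<open>D\<close> odd, and \<open>y0\<close> alone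
    supplies the last entry 1 that clears the vectors of \<open>D\<close>.\<close>
  define D where "D = {y\<in>B. y $ n = 1} - {y0}"
  have "even (card {y\<in>B. y $ n = 1})"
    using sum_bit_eq_parity[OF fin, of "\<lambda>y. y $ n"] False by (auto split: if_splits)
  moreover have "card {y\<in>B. y $ n = 1} = Suc (card D)"
    unfolding D_def using fin y0 by (intro card.remove) auto
  ultimately have "odd (card D)" by simp
  moreover have DB: "D \<subseteq> B" by (auto simp: D_def)
  ultimately obtain g where g: "inj_on g B" "g ` B \<in> code_bases N C" "A2 n (g ` B) = A2 n B"
    "\<And>y. y \<in> B \<Longrightarrow> g y $ n = y $ n + of_bool (y \<in> D) * (\<Sum>y\<in>B - D. y $ n)"
    using ex_transvection[OF B DB] by blast
  have "(\<Sum>y\<in>B - D. y $ n) = (\<Sum>y\<in>{y0}. y $ n)"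
    using fin y0 by (intro sum.mono_neutral_right) (auto simp: D_def)
  then have "g y $ n = of_bool (y = y0)" if "y \<in> B" for y
    using g(4)[OF that] that y0 by (cases "y $ n") (auto simp: D_def)
  then have "(\<Sum>y\<in>g ` B. y $ n) = 1"
    using fin y0 by (simp add: sum.reindex[OF g(1)] of_bool_def)
  moreover have "even (card (g ` B))" using even by (simp add: card_image[OF g(1)])
  ultimately show ?thesis
    using ex_A2_eq_ones_if_odd[OF g(2)] g(3) that by metis
qed

section \<open>Closure of the family under inversion\<close>

text \<open>Closure gives one inclusion of the theorem; involutivity exhibits each member as an
  inverse and gives the other.\<close>

lemma mat_inv_family:
  assumes "A \<in> family_F n C"
  shows "mat_inv A \<in> family_F n C \<and> mat_inv (mat_inv A) = A"
proof -
  have inverse: "mat_inv A = X \<and> mat_inv X = A"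
    if "A \<in> carrier_mat n n" "X \<in> carrier_mat n n" "A * X = 1\<^sub>m n" for A X :: "bit mat"
    using that mat_inv_eqI mat_mult_left_right_inverse by blast
  have A1c: "A1 n B \<in> carrier_mat n n" and A2c: "A2 n B \<in> carrier_mat n n" for B
    by (auto simp: A1_def A2_def mat_sum_def)
  have cardB: "card B = (n + 1) div 2" if "B \<in> code_bases N C" for B
    using card_code_basis[OF sd that] N by simp
  have fam: "family_F n C = (if even ((n + 1) div 2)
      then A1 n ` code_bases2 N C \<union> A2 n ` code_bases N C else A1 n ` code_bases2 N C)"
    by (simp add: family_F_def N)
  consider (A1) B where "B \<in> code_bases2 N C" "A = A1 n B"
    | (A2) B where "even ((n + 1) div 2)" "B \<in> code_bases N C" "A = A2 n B"
    using assms unfolding fam by (auto split: if_splits)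
  then show ?thesis
  proof cases
    case A1
    then have B: "B \<in> code_bases N C" by (simp add: code_bases2_iff)
    show ?thesis
    proof (cases "\<exists>k\<in>B. k $ n = 0")
      case True
      then obtain B' where "B' \<in> code_bases2 N C" "A1 n B * A1 n B' = 1\<^sub>m n"
        using ex_A1_mult_A1_eq_1[OF A1(1)] by blast
      then show ?thesis using inverse[OF A1c A1c] A1(2) unfolding fam by auto
    next
      case False
      then have ones: "y $ n = 1" if "y \<in> B" for y using that by auto
      have "(\<Sum>y\<in>B. y $ n) = 0" using A1(1) by (simp add: code_bases2_iff)
      \<comment> \<open>An all-ones column of even weight forces \<open>m\<close> to be even, which
        is when the matrices A'' belong to the family.\<close>
      then have even: "even (card B)" using ones by (simp add: of_nat_bit split: if_splits)
      show ?thesis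
        using inverse[OF A1c A2c A1_mult_A2_eq_1[OF B ones even]] A1(2) B even cardB[OF B]
        unfolding fam by auto
    qed
  next
    case A2
    then have "even (card B)" using cardB by simp
    then obtain B' where B': "B' \<in> code_bases N C" "A2 n B' = A2 n B" "\<And>y. y \<in> B' \<Longrightarrow> y $ n = 1"
      using ex_A2_eq_ones[OF A2(2)] by blast
    have even: "even (card B')" using A2(1) cardB[OF B'(1)] by simp
    \<comment> \<open>The all-ones column now has even weight, so A' of \<open>B'\<close> is a
      member and inverts the given matrix.\<close>
    then have "B' \<in> code_bases2 N C" using B' by (simp add: code_bases2_iff of_nat_bit)
    then show ?thesis
      using inverse[OF A1c A2c A1_mult_A2_eq_1[OF B'(1,3) even]] A2 B'(2)
      unfolding fam by auto
  qed
qed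

end

theorem theorem8p6:
  fixes n :: nat and C :: "bit vec set"
  assumes "odd n" and "n \<ge> 3"
    and "self_dual (n + 1) C"
  shows "mat_inv ` family_F n C = family_F n C"
proof -
  interpret self_dual_code n "n + 1" C
    using assms(3) by unfold_locales simp_all
  show ?thesis
    using mat_inv_family by (metis image_subset_iff imageI subsetI subset_antisym)
qed

end
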